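(* Let $f:\mathbb{R}^d\to\mathbb{R}$ be smooth with global minimizer $x^*$, and let $\mu>0$, $\alpha>0$. Assume that $\gamma>0$, that $A(x)\in\mathbb{R}^{d\times d}$ is symmetric positive semidefinite for all $x\in\mathbb{R}^d$ and bounded over compact sets, and that there exist $a,b>0$ such that, for all $x\in\mathbb{R}^d$, $$a\left[f(x)-f(x^* )\right]+b\|x-x^*\|^2\le (x-x^* )\cdot\left(\nabla f(x)-\nabla f(x^* )\right).$$ Then, for any initial condition $(x_0,p_0,\xi_0)\in\mathbb{R}^d\times\mathbb{R}^d\times[0,\infty)$, there exist $\kappa>0$ and $C\ge 0$ (possibly depending on the initial condition) such that the solution $(x(t),p(t),\xi(t))_{t\ge0}$ of the friction-adaptive descent (FAD) dynamics with parameters $\mu,\alpha,\gamma$ started from $(x_0,p_0,\xi_0)$ satisfies, for all $t\ge 0$, $$f(x(t))-f(x^* )+\|p(t)\|+\xi(t)\le C\,\mathrm{e}^{-\kappa t}.$$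
   Context: The friction-adaptive descent (FAD) dynamics associated with $f:\mathbb{R}^d\to\mathbb{R}$, the matrix-valued function $A:\mathbb{R}^d\to\mathbb{R}^{d\times d}$ and the real parameters $\mu,\alpha,\gamma$ is the following system of ODEs for $(x,p,\xi)\in\mathbb{R}^d\times\mathbb{R}^d\times\mathbb{R}$: $$\dot x=p,\qquad \dot p=-\nabla f(x)-\xi A(x)p-\gamma p,\qquad \dot\xi=\mu^{-1}p^TA(x)p-\alpha\xi .$$ $\|\cdot\|$ is the Euclidean norm. *)

theory Defs
  imports "HOL-Analysis.Analysis"
begin

text \<open>
  A function is of class \<open>C\<^sup>k\<^sup>+\<^sup>1\<close> iff it is differentiable everywhere and all its directional
  derivatives are of class \<open>C\<^sup>k\<close>.  On a finite-dimensional domain this is the usual notion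
  (all partial derivatives up to order \<open>k + 1\<close> exist and are continuous).
\<close>

primrec C_class :: "nat \<Rightarrow> ('a::euclidean_space \<Rightarrow> real) \<Rightarrow> bool" where
  "C_class 0 f \<longleftrightarrow> continuous_on UNIV f"
| "C_class (Suc k) f \<longleftrightarrow>
     (\<forall>x. f differentiable (at x)) \<and> (\<forall>v. C_class k (\<lambda>x. frechet_derivative f (at x) v))"

definition smooth :: "('a::euclidean_space \<Rightarrow> real) \<Rightarrow> bool" where
  "smooth f \<longleftrightarrow> (\<forall>k. C_class k f)"

text \<open>Only meaningful where \<open>f\<close> is differentiable; see \<open>smooth_GDERIV_gradient\<close> below.\<close>

definition gradient :: "('a::euclidean_space \<Rightarrow> real) \<Rightarrow> 'a \<Rightarrow> 'a" where
  "gradient f x = (THE D. GDERIV f x :> D)"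

lemma GDERIV_imp_gradient:
  assumes "GDERIV f x :> D"
  shows "gradient f x = D"
  unfolding gradient_def
proof (rule the_equality)
  fix E assume "GDERIV f x :> E"
  then have "(\<lambda>h. h \<bullet> E) = (\<lambda>h. h \<bullet> D)"
    using assms unfolding gderiv_def by (rule has_derivative_unique)
  then show "E = D"
    unfolding vector_eq_ldot[of E D, symmetric] by (rule fun_cong[THEN allI])
qed (fact assms)

lemma smooth_GDERIV_gradient:
  assumes "smooth f"
  shows "GDERIV f x :> gradient f x"
proof -
  have "C_class (Suc 0) f"
    using assms unfolding smooth_def by blast
  then have "f differentiable (at x)"
    by simp
  then obtain f' where f': "(f has_derivative f') (at x)"
    unfolding differentiable_def by blast
  have "linear f'"
    using f' by (rule has_derivative_linear)
  then have "f' = (\<lambda>h. h \<bullet> adjoint f' 1)"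
    by (metis adjoint_works inner_real_def mult.right_neutral)
  with f' have "GDERIV f x :> adjoint f' 1"
    unfolding gderiv_def by metis
  then show ?thesis
    by (metis GDERIV_imp_gradient)
qed

definition symmetric_psd :: "real ^ 'n ^ 'n \<Rightarrow> bool" where
  "symmetric_psd M \<longleftrightarrow> transpose M = M \<and> (\<forall>v. 0 \<le> v \<bullet> (M *v v))"

definition bounded_on_compacts :: "('a::topological_space \<Rightarrow> 'b::metric_space) \<Rightarrow> bool" where
  "bounded_on_compacts F \<longleftrightarrow> (\<forall>K. compact K \<longrightarrow> bounded (F ` K))"

text \<open>
  Classical solutions on \<open>[0, \<infinity>)\<close>, with one-sided derivatives at time \<open>0\<close>.
\<close>

definition FAD_solution ::
  "(real ^ 'n \<Rightarrow> real) \<Rightarrow> (real ^ 'n \<Rightarrow> real ^ 'n ^ 'n) \<Rightarrow> real \<Rightarrow> real \<Rightarrow> real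
    \<Rightarrow> (real \<Rightarrow> real ^ 'n) \<Rightarrow> (real \<Rightarrow> real ^ 'n) \<Rightarrow> (real \<Rightarrow> real) \<Rightarrow> bool" where
  "FAD_solution f A \<mu> \<alpha> \<gamma> x p \<xi> \<longleftrightarrow>
    (\<forall>t\<ge>0.
      (x has_vector_derivative p t) (at t within {0..}) \<and>
      (p has_vector_derivative
        - gradient f (x t) - \<xi> t *\<^sub>R (A (x t) *v p t) - \<gamma> *\<^sub>R p t) (at t within {0..}) \<and>
      (\<xi> has_real_derivative
        inverse \<mu> * (p t \<bullet> (A (x t) *v p t)) - \<alpha> * \<xi> t) (at t within {0..}))"

end

theory Submission
  imports Defs
begin

text \<open>
  Write \<open>X = x - xstar\<close> and let \<open>H = f x - f xstar + \<parallel>p\<parallel>\<^sup>2 / 2 + \<mu> \<xi>\<^sup>2 / 2\<close> be the energy.  The friction terms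
  cancel in \<open>H' = - \<gamma> \<parallel>p\<parallel>\<^sup>2 - \<alpha> \<mu> \<xi>\<^sup>2\<close>, so \<open>H\<close> is nonincreasing; integrating the convexity-type
  hypothesis along rays gives \<open>b \<parallel>X\<parallel>\<^sup>2 / 2 \<le> f x - f xstar\<close>, and therefore \<open>X\<close>, \<open>\<xi>\<close> and
  \<open>A x\<close> stay bounded in terms of the initial condition.  The missing dissipation in the position
  comes from the cross term \<open>W = X \<bullet> p + \<gamma> \<parallel>X\<parallel>\<^sup>2 / 2\<close>, whose derivative
  \<open>\<parallel>p\<parallel>\<^sup>2 - X \<bullet> \<nabla>f x - \<xi> X \<bullet> A p\<close> is at most \<open>N \<parallel>p\<parallel>\<^sup>2 - a (f x - f xstar)\<close> for a constant \<open>N\<close>.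
  For small \<open>\<epsilon>\<close> the function \<open>H + \<epsilon> W\<close> is comparable to \<open>H\<close> and decays exponentially.
\<close>

section \<open>Scalar differential inequalities on the half-line\<close>

lemma nonincreasing_on_halfline:
  fixes u :: "real \<Rightarrow> real"
  assumes deriv: "\<And>t. t \<ge> 0 \<Longrightarrow> (u has_real_derivative u' t) (at t within {0..})"
    and nonpos: "\<And>t. t > 0 \<Longrightarrow> u' t \<le> 0"
    and t: "t \<ge> 0"
  shows "u t \<le> u 0"
proof (rule DERIV_nonpos_imp_decreasing_open[OF t])
  fix s :: real assume "0 < s"
  moreover have "at s within {0..} = at s"
    using \<open>0 < s\<close> by (intro at_within_interior) simp
  ultimately show "\<exists>y. (u has_real_derivative y) (at s) \<and> y \<le> 0"
    using deriv[of s] nonpos[of s] by auto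
next
  have "continuous_on {0..} u"
    using deriv by (intro DERIV_continuous_on) auto
  then show "continuous_on {0..t} u"
    by (rule continuous_on_subset) auto
qed

text \<open>Gronwall's inequality: the integrating factor \<open>exp (k * t)\<close> makes the
  product nonincreasing.\<close>

lemma exponential_decay_on_halfline:
  fixes u :: "real \<Rightarrow> real"
  assumes deriv: "\<And>t. t \<ge> 0 \<Longrightarrow> (u has_real_derivative u' t) (at t within {0..})"
    and bound: "\<And>t. t \<ge> 0 \<Longrightarrow> u' t \<le> - k * u t"
    and t: "t \<ge> 0"
  shows "u t \<le> u 0 * exp (- k * t)"
proof -
  have "u t * exp (k * t) \<le> u 0 * exp (k * 0)"
  proof (rule nonincreasing_on_halfline[OF _ _ t])
    show "((\<lambda>s. u s * exp (k * s)) has_real_derivative (u' s + k * u s) * exp (k * s))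
        (at s within {0..})" if "s \<ge> 0" for s
      using that by (auto intro!: derivative_eq_intros deriv simp: algebra_simps)
    show "(u' s + k * u s) * exp (k * s) \<le> 0" if "s > 0" for s
      using bound[of s] that by (simp add: mult_le_0_iff)
  qed
  then show ?thesis
    by (simp add: exp_minus field_simps)
qed

section \<open>Static consequences of the hypotheses: gradients, growth, matrix bounds\<close>

lemma GDERIV_minimum_eq_0:
  fixes f :: "'a::real_inner \<Rightarrow> real"
  assumes "GDERIV f z :> D" and "\<And>y. f z \<le> f y"
  shows "D = 0"
proof -
  have "(\<lambda>h. h \<bullet> D) = (\<lambda>h. 0)"
    using assms unfolding gderiv_def
    by (intro differential_zero_maxmin[of z UNIV f]) auto
  then have "D \<bullet> D = 0"
    by (rule fun_cong)
  then show ?thesis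
    by simp
qed

lemma GDERIV_compose_has_real_derivative:
  fixes x :: "real \<Rightarrow> 'a::real_inner"
  assumes "GDERIV f (x t) :> D" and "(x has_vector_derivative v) (at t within S)"
  shows "((\<lambda>s. f (x s)) has_real_derivative v \<bullet> D) (at t within S)"
proof -
  have "((\<lambda>s. f (x s)) has_derivative (\<lambda>h. (h *\<^sub>R v) \<bullet> D)) (at t within S)"
    using assms(2,1) unfolding gderiv_def has_vector_derivative_def
    by (rule has_derivative_compose)
  moreover have "(\<lambda>h. (h *\<^sub>R v) \<bullet> D) = (*) (v \<bullet> D)"
    by (simp add: fun_eq_iff)
  ultimately show ?thesis
    unfolding has_field_derivative_def by simp
qed

text \<open>Along the ray from \<open>z\<close> to \<open>y\<close> the slope of \<open>f\<close> at
  parameter \<open>s\<close> is at least \<open>b * (norm (y - z))\<^sup>2 * s\<close>. Instead of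
  integrating this over the unit interval, the difference \<open>?u\<close> of the two
  antiderivatives is shown to be nonincreasing.\<close>

lemma quadratic_growth:
  fixes f :: "'a::real_inner \<Rightarrow> real"
  assumes grad: "\<And>y. GDERIV f y :> g y"
    and mono: "\<And>y. b * (norm (y - z))\<^sup>2 \<le> (y - z) \<bullet> g y"
  shows "b / 2 * (norm (y - z))\<^sup>2 \<le> f y - f z"
proof -
  define v where "v = y - z"
  let ?u = "\<lambda>s. b * (norm v)\<^sup>2 * s\<^sup>2 / 2 - f (z + s *\<^sub>R v)"
  have "?u 1 \<le> ?u 0"
  proof (rule nonincreasing_on_halfline)
    show "(?u has_real_derivative b * (norm v)\<^sup>2 * s - v \<bullet> g (z + s *\<^sub>R v))
        (at s within {0..})" for s
    proof -
      have "((\<lambda>s. z + s *\<^sub>R v) has_vector_derivative v) (at s within {0..})"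
        by (auto intro!: derivative_eq_intros)
      note [derivative_intros] = GDERIV_compose_has_real_derivative[OF grad this]
      show ?thesis
        by (auto intro!: derivative_eq_intros)
    qed
    show "b * (norm v)\<^sup>2 * s - v \<bullet> g (z + s *\<^sub>R v) \<le> 0" if "s > 0" for s
    proof -
      \<comment> \<open>At a ray point \<open>mono\<close> carries a factor \<open>s\<close> on both
        sides; it cancels because only \<open>s > 0\<close> is considered.\<close>
      have "s * (b * (norm v)\<^sup>2 * s) \<le> s * (v \<bullet> g (z + s *\<^sub>R v))"
        using mono[of "z + s *\<^sub>R v"]
        by (simp add: power_mult_distrib power2_eq_square algebra_simps)
      then show ?thesis
        using that by simp
    qed
  qed simp
  then show ?thesis
    by (simp add: v_def)
qed

text \<open>Each entry is bounded by the norm of the matrix, and a common bound on the entries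
  bounds the operator norm, up to the number of entries. This turns boundedness of \<open>A\<close>
  on a ball into an estimate for \<open>A y *v v\<close>.\<close>

lemma bounded_matrices_imp_bounded_operators:
  fixes S :: "(real ^ 'n ^ 'm) set"
  assumes "bounded S"
  obtains M where "M \<ge> 0" and "\<And>B v. B \<in> S \<Longrightarrow> norm (B *v v) \<le> M * norm v"
proof -
  obtain c where c: "c > 0" "\<And>B. B \<in> S \<Longrightarrow> norm B \<le> c"
    using assms unfolding bounded_pos by blast
  define M where "M = real CARD('m) * real CARD('n) * c"
  show thesis
  proof
    show "M \<ge> 0"
      using c by (simp add: M_def)
    fix B :: "real ^ 'n ^ 'm" and v
    assume "B \<in> S"
    have "\<bar>B $ i $ j\<bar> \<le> c" for i j
      using component_le_norm_cart[of "B $ i" j] Finite_Cartesian_Product.norm_nth_le[of B i]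
        c(2)[OF \<open>B \<in> S\<close>] by linarith
    then have "onorm ((*v) B) \<le> M"
      unfolding M_def by (rule onorm_le_matrix_component)
    then show "norm (B *v v) \<le> M * norm v"
      using onorm[OF matrix_vector_mul_bounded_linear, of B v]
      by (meson mult_right_mono norm_ge_zero order_trans)
  qed
qed

section \<open>Derivatives of the energy and the cross term along solutions\<close>

text \<open>The power of \<open>gradient f\<close> cancels between \<open>f\<close> and the kinetic
  energy. The weight \<open>\<mu> / 2\<close> on the square of \<open>\<xi>\<close> makes the
  adaptive friction cancel against the source term of the \<open>\<xi>\<close> equation.\<close>

lemma FAD_energy_deriv:
  assumes grad: "\<And>y. GDERIV f y :> gradient f y"
    and "\<mu> > 0"
    and sol: "FAD_solution f A \<mu> \<alpha> \<gamma> x p \<xi>"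
    and "t \<ge> 0"
  shows "((\<lambda>t. f (x t) - f xstar + (p t \<bullet> p t) / 2 + \<mu> * (\<xi> t)\<^sup>2 / 2) has_real_derivative
      - \<gamma> * (norm (p t))\<^sup>2 - \<alpha> * \<mu> * (\<xi> t)\<^sup>2) (at t within {0..})"
proof -
  note ode = sol[unfolded FAD_solution_def, rule_format, OF \<open>t \<ge> 0\<close>]
  note [derivative_intros] = GDERIV_compose_has_real_derivative[OF grad conjunct1[OF ode]]
  note x' = conjunct1[OF ode] and p' = conjunct1[OF conjunct2[OF ode]]
    and \<xi>' = conjunct2[OF conjunct2[OF ode]]
  have pp: "((\<lambda>t. p t \<bullet> p t) has_real_derivative
      2 * (p t \<bullet> (- gradient f (x t) - \<xi> t *\<^sub>R (A (x t) *v p t) - \<gamma> *\<^sub>R p t))) (at t within {0..})"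
    using bounded_bilinear.has_vector_derivative[OF bounded_bilinear_inner p' p']
    by (simp add: has_real_derivative_iff_has_vector_derivative inner_commute)
  have "((\<lambda>t. f (x t) - f xstar + (p t \<bullet> p t) / 2 + \<mu> * (\<xi> t)\<^sup>2 / 2) has_real_derivative
      p t \<bullet> gradient f (x t)
      + 2 * (p t \<bullet> (- gradient f (x t) - \<xi> t *\<^sub>R (A (x t) *v p t) - \<gamma> *\<^sub>R p t)) / 2
      + \<mu> * (2 * \<xi> t * (inverse \<mu> * (p t \<bullet> (A (x t) *v p t)) - \<alpha> * \<xi> t)) / 2)
      (at t within {0..})"
    by (rule derivative_eq_intros pp \<xi>' refl | simp)+
  moreover have "p t \<bullet> gradient f (x t)
      + 2 * (p t \<bullet> (- gradient f (x t) - \<xi> t *\<^sub>R (A (x t) *v p t) - \<gamma> *\<^sub>R p t)) / 2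
      + \<mu> * (2 * \<xi> t * (inverse \<mu> * (p t \<bullet> (A (x t) *v p t)) - \<alpha> * \<xi> t)) / 2
      = - \<gamma> * (norm (p t))\<^sup>2 - \<alpha> * \<mu> * (\<xi> t)\<^sup>2"
    using \<open>\<mu> > 0\<close>
    by (simp add: field_simps inner_diff_right inner_add_right dot_square_norm power2_eq_square)
  ultimately show ?thesis
    by simp
qed

text \<open>The quadratic term with weight \<open>\<gamma> / 2\<close> is there to cancel the
  damping contribution \<open>- \<gamma> * ((x t - z) \<bullet> p t)\<close> of the product
  rule.\<close>

lemma FAD_cross_term_deriv:
  assumes sol: "FAD_solution f A \<mu> \<alpha> \<gamma> x p \<xi>"
    and "t \<ge> 0"
  shows "((\<lambda>t. (x t - z) \<bullet> p t + \<gamma> / 2 * ((x t - z) \<bullet> (x t - z))) has_real_derivative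
      (norm (p t))\<^sup>2 - (x t - z) \<bullet> gradient f (x t) - \<xi> t * ((x t - z) \<bullet> (A (x t) *v p t)))
      (at t within {0..})"
proof -
  note ode = sol[unfolded FAD_solution_def, rule_format, OF \<open>t \<ge> 0\<close>]
  note p' = conjunct1[OF conjunct2[OF ode]]
  have X': "((\<lambda>t. x t - z) has_vector_derivative p t) (at t within {0..})"
    using conjunct1[OF ode] by (auto intro!: derivative_eq_intros)
  have "((\<lambda>t. (x t - z) \<bullet> p t) has_real_derivative
      (x t - z) \<bullet> (- gradient f (x t) - \<xi> t *\<^sub>R (A (x t) *v p t) - \<gamma> *\<^sub>R p t) + p t \<bullet> p t)
      (at t within {0..})"
    using bounded_bilinear.has_vector_derivative[OF bounded_bilinear_inner X' p']
    by (simp add: has_real_derivative_iff_has_vector_derivative)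
  moreover have "((\<lambda>t. (x t - z) \<bullet> (x t - z)) has_real_derivative 2 * ((x t - z) \<bullet> p t))
      (at t within {0..})"
    using bounded_bilinear.has_vector_derivative[OF bounded_bilinear_inner X' X']
    by (simp add: has_real_derivative_iff_has_vector_derivative inner_commute)
  ultimately have "((\<lambda>t. (x t - z) \<bullet> p t + \<gamma> / 2 * ((x t - z) \<bullet> (x t - z))) has_real_derivative
      (x t - z) \<bullet> (- gradient f (x t) - \<xi> t *\<^sub>R (A (x t) *v p t) - \<gamma> *\<^sub>R p t) + p t \<bullet> p t
      + \<gamma> / 2 * (2 * ((x t - z) \<bullet> p t))) (at t within {0..})"
    by (intro DERIV_add DERIV_cmult)
  then show ?thesis
    by (simp add: inner_diff_right dot_square_norm algebra_simps)
qed

section \<open>Lyapunov function and exponential convergence\<close>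

theorem theorem3p4:
  fixes f :: "real ^ 'n \<Rightarrow> real"
    and A :: "real ^ 'n \<Rightarrow> real ^ 'n ^ 'n"
    and xstar :: "real ^ 'n"
    and \<mu> \<alpha> \<gamma> :: real
  assumes "smooth f"
    and "\<forall>x. f xstar \<le> f x"
    and "\<mu> > 0" and "\<alpha> > 0" and "\<gamma> > 0"
    and "\<forall>x. symmetric_psd (A x)"
    and "bounded_on_compacts A"
    and "\<exists>a>0. \<exists>b>0. \<forall>x.
      a * (f x - f xstar) + b * (norm (x - xstar))\<^sup>2
        \<le> (x - xstar) \<bullet> (gradient f x - gradient f xstar)"
  shows "\<forall>x0 p0 \<xi>0. \<xi>0 \<ge> 0 \<longrightarrow>
    (\<exists>\<kappa>>0. \<exists>C\<ge>0. \<forall>x p \<xi>.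
      FAD_solution f A \<mu> \<alpha> \<gamma> x p \<xi> \<and> x 0 = x0 \<and> p 0 = p0 \<and> \<xi> 0 = \<xi>0 \<longrightarrow>
      (\<forall>t\<ge>0. f (x t) - f xstar + norm (p t) + \<xi> t \<le> C * exp (- \<kappa> * t)))"
proof (intro allI impI)
  fix x0 p0 :: "real ^ 'n" and \<xi>0 :: real
  have grad: "GDERIV f y :> gradient f y" for y
    using \<open>smooth f\<close> by (rule smooth_GDERIV_gradient)
  have min: "f xstar \<le> f y" for y
    using assms(2) by blast
  have "gradient f xstar = 0"
    using GDERIV_minimum_eq_0[OF grad min] .
  then obtain a b where ab: "a > 0" "b > 0"
    and conv: "\<And>y. a * (f y - f xstar) + b * (norm (y - xstar))\<^sup>2
      \<le> (y - xstar) \<bullet> gradient f y"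
    using assms(8) by auto
  have growth: "b / 2 * (norm (y - xstar))\<^sup>2 \<le> f y - f xstar" for y
  proof (rule quadratic_growth[OF grad])
    fix y
    have "0 \<le> a * (f y - f xstar)"
      using ab min by simp
    then show "b * (norm (y - xstar))\<^sup>2 \<le> (y - xstar) \<bullet> gradient f y"
      using conv[of y] by linarith
  qed

  define H where "H y q s = f y - f xstar + (q \<bullet> q) / 2 + \<mu> * s\<^sup>2 / 2"
    for y q :: "real ^ 'n" and s
  define W where "W y q = (y - xstar) \<bullet> q + \<gamma> / 2 * ((y - xstar) \<bullet> (y - xstar))"
    for y q :: "real ^ 'n"
  define H0 where "H0 = H x0 p0 \<xi>0"
  have H_ge: "f y - f xstar \<le> H y q s" "(norm q)\<^sup>2 \<le> 2 * H y q s" "s\<^sup>2 \<le> 2 * H y q s / \<mu>"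
    "0 \<le> H y q s" for y q s
  proof -
    have "f y - f xstar \<ge> 0" "q \<bullet> q \<ge> 0" "\<mu> * s\<^sup>2 \<ge> 0"
      using min \<open>\<mu> > 0\<close> by auto
    then show "f y - f xstar \<le> H y q s" "(norm q)\<^sup>2 \<le> 2 * H y q s" "0 \<le> H y q s"
      by (auto simp: H_def dot_square_norm)
    from \<open>f y - f xstar \<ge> 0\<close> \<open>q \<bullet> q \<ge> 0\<close> have "\<mu> * s\<^sup>2 \<le> 2 * H y q s"
      by (auto simp: H_def)
    then show "s\<^sup>2 \<le> 2 * H y q s / \<mu>"
      using \<open>\<mu> > 0\<close> by (simp add: field_simps)
  qed

  \<comment> \<open>By \<open>growth\<close> and the monotonicity of the energy, a trajectory with
    initial energy \<open>H0\<close> never leaves this ball. The constants below are chosen before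
    any trajectory is fixed, as the order of quantifiers requires.\<close>
  have "bounded (A ` cball xstar (sqrt (2 * H0 / b)))"
    using assms(7) compact_cball unfolding bounded_on_compacts_def by blast
  then obtain M where "M \<ge> 0"
    and M: "\<And>y v. y \<in> cball xstar (sqrt (2 * H0 / b)) \<Longrightarrow> norm (A y *v v) \<le> M * norm v"
    by (metis bounded_matrices_imp_bounded_operators imageI)

  \<comment> \<open>\<open>K\<close> bounds the coefficient of
    \<open>norm (x t - xstar) * norm (p t)\<close> in the friction coupling, since
    \<open>\<bar>\<xi> t\<bar> \<le> sqrt (2 * H0 / \<mu>)\<close>. In \<open>N\<close>, the
    \<open>1\<close> is the kinetic term of the derivative of \<open>W\<close> and the rest comes
    from Young's inequality.\<close>
  define K where "K = sqrt (2 * H0 / \<mu>) * M"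
  define N where "N = 1 + K\<^sup>2 / (4 * b)"
  \<comment> \<open>With this choice \<open>\<epsilon> * N\<close> uses up exactly half of the
    friction \<open>\<gamma>\<close>.\<close>
  define \<epsilon> where "\<epsilon> = \<gamma> / (2 * N)"
  define c where "c = 1 + \<epsilon> * (1 + (1 + \<gamma>) / b)"
  \<comment> \<open>The three entries are the dissipation rates left for the kinetic,
    \<open>\<xi>\<close> and potential parts of \<open>H\<close>.\<close>
  define l where "l = min \<gamma> (min (2 * \<alpha>) (\<epsilon> * a))"
  have "N \<ge> 1"
    using ab by (simp add: N_def)
  have \<epsilon>: "\<epsilon> > 0" "\<epsilon> \<le> \<gamma> / 2" "\<epsilon> * N = \<gamma> / 2"
    using \<open>N \<ge> 1\<close> \<open>\<gamma> > 0\<close> by (auto simp: \<epsilon>_def field_simps)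
  have "c > 0"
    using ab \<epsilon> \<open>\<gamma> > 0\<close> by (simp add: c_def add_pos_pos)
  have "l > 0"
    using ab \<epsilon> assms by (simp add: l_def)

  \<comment> \<open>\<open>W\<close> may be negative, but completing the square gives
    \<open>0 \<le> \<gamma> * W y q + H y q s\<close>, so
    \<open>\<epsilon> \<le> \<gamma> / 2\<close> costs at most half of \<open>H\<close>.\<close>
  have lower: "H y q s \<le> 2 * (H y q s + \<epsilon> * W y q)" for y q s
  proof -
    have cs: "\<bar>(y - xstar) \<bullet> q\<bar> \<le> norm (y - xstar) * norm q"
      by (rule Cauchy_Schwarz_ineq2)
    have "0 \<le> (\<gamma> * norm (y - xstar) - norm q)\<^sup>2"
      by simp
    then have "0 \<le> \<gamma> * (\<gamma> * (norm (y - xstar))\<^sup>2 - 2 * (norm (y - xstar) * norm q)) + (norm q)\<^sup>2"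
      by (simp add: power2_diff power_mult_distrib power2_eq_square algebra_simps)
    also have "\<dots> \<le> \<gamma> * (2 * W y q) + (norm q)\<^sup>2"
    proof -
      have "\<gamma> * (norm (y - xstar))\<^sup>2 - 2 * (norm (y - xstar) * norm q) \<le> 2 * W y q"
        using cs by (auto simp: W_def dot_square_norm algebra_simps)
      then show ?thesis
        using \<open>\<gamma> > 0\<close> by simp
    qed
    also have "\<dots> \<le> \<gamma> * (2 * W y q) + 2 * H y q s"
      using H_ge by simp
    finally have *: "0 \<le> \<gamma> * W y q + H y q s"
      by simp
    have "\<gamma> / 2 * (2 * \<epsilon> * W y q + H y q s) \<ge> 0"
      using mult_left_mono[OF *, of \<epsilon>] mult_right_mono[OF \<epsilon>(2) H_ge(4)[of y q s]] \<epsilon>(1)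
      by (simp add: algebra_simps)
    then show ?thesis
      using \<open>\<gamma> > 0\<close> by (simp add: zero_le_mult_iff)
  qed
  have upper: "H y q s + \<epsilon> * W y q \<le> c * H y q s" for y q s
  proof -
    have cs: "\<bar>(y - xstar) \<bullet> q\<bar> \<le> norm (y - xstar) * norm q"
      by (rule Cauchy_Schwarz_ineq2)
    have "0 \<le> (norm (y - xstar) - norm q)\<^sup>2"
      by simp
    with cs have "W y q \<le> (1 + \<gamma>) / 2 * (norm (y - xstar))\<^sup>2 + (norm q)\<^sup>2 / 2"
      by (simp add: W_def dot_square_norm power2_diff field_simps)
    moreover have "(norm (y - xstar))\<^sup>2 \<le> 2 * H y q s / b"
      using growth[of y] H_ge(1)[of y q s] ab by (simp add: field_simps)
    then have "(1 + \<gamma>) / 2 * (norm (y - xstar))\<^sup>2 \<le> (1 + \<gamma>) / 2 * (2 * H y q s / b)"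
      using \<open>\<gamma> > 0\<close> by (intro mult_left_mono) auto
    moreover have "(1 + \<gamma>) / 2 * (2 * H y q s / b) = (1 + \<gamma>) / b * H y q s"
      by simp
    ultimately have "W y q \<le> (1 + (1 + \<gamma>) / b) * H y q s"
      using H_ge(2)[of q y s] unfolding distrib_right by linarith
    then have "\<epsilon> * W y q \<le> \<epsilon> * ((1 + (1 + \<gamma>) / b) * H y q s)"
      using \<epsilon> by simp
    then show ?thesis
      by (simp add: c_def algebra_simps)
  qed

  define L0 where "L0 = H0 + \<epsilon> * W x0 p0"
  have "L0 \<ge> 0"
    using lower[of x0 p0 \<xi>0] H_ge(4)[of x0 p0 \<xi>0] by (simp add: L0_def H0_def)
  define k where "k = l / c"
  \<comment> \<open>The rate is halved because \<open>norm (p t)\<close> and \<open>\<xi> t\<close>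
    are controlled only by the square root of \<open>H\<close>. The radicands in \<open>C\<close>
    come from \<open>H \<le> 2 * L0 * exp (- k * t)\<close> and \<open>H_ge\<close>.\<close>
  define \<kappa> where "\<kappa> = k / 2"
  define C where "C = 2 * L0 + sqrt (4 * L0) + sqrt (4 * L0 / \<mu>)"
  have "\<kappa> > 0" "k > 0"
    using \<open>l > 0\<close> \<open>c > 0\<close> by (simp_all add: \<kappa>_def k_def)
  have "C \<ge> 0"
    using \<open>L0 \<ge> 0\<close> \<open>\<mu> > 0\<close> by (simp add: C_def)

  have "f (x t) - f xstar + norm (p t) + \<xi> t \<le> C * exp (- \<kappa> * t)"
    if sol: "FAD_solution f A \<mu> \<alpha> \<gamma> x p \<xi>" and init: "x 0 = x0" "p 0 = p0" "\<xi> 0 = \<xi>0"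
      and "t \<ge> 0" for x p \<xi> t
  proof -
    note H' = FAD_energy_deriv[where xstar = xstar, OF grad \<open>\<mu> > 0\<close> sol, folded H_def]
    note W' = FAD_cross_term_deriv[where z = xstar, OF sol, folded W_def]
    let ?H = "\<lambda>t. H (x t) (p t) (\<xi> t)"
    let ?W = "\<lambda>t. W (x t) (p t)"
    have H_le: "?H t \<le> H0" if "t \<ge> 0" for t
    proof -
      have "- \<gamma> * (norm (p s))\<^sup>2 - \<alpha> * \<mu> * (\<xi> s)\<^sup>2 \<le> 0" for s
      proof -
        have "0 \<le> \<gamma> * (norm (p s))\<^sup>2" "0 \<le> \<alpha> * \<mu> * (\<xi> s)\<^sup>2"
          using assms(3-5) by simp_all
        then show ?thesis
          by simp
      qed
      then have "?H t \<le> ?H 0"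
        using that by - (rule nonincreasing_on_halfline[OF H'])
      then show ?thesis
        by (simp add: H0_def init)
    qed
    have W'_le: "(norm (p t))\<^sup>2 - (x t - xstar) \<bullet> gradient f (x t)
        - \<xi> t * ((x t - xstar) \<bullet> (A (x t) *v p t)) \<le> N * (norm (p t))\<^sup>2 - a * (f (x t) - f xstar)"
      if "t \<ge> 0" for t
    proof -
      let ?n = "norm (x t - xstar)" and ?q = "norm (p t)"
      have "?n\<^sup>2 \<le> 2 * H0 / b"
        using growth[of "x t"] H_ge(1)[of "x t" "p t" "\<xi> t"] H_le[OF that] ab
        by (simp add: field_simps)
      then have "x t \<in> cball xstar (sqrt (2 * H0 / b))"
        by (simp add: dist_norm norm_minus_commute real_le_rsqrt)
      then have Ap: "norm (A (x t) *v p t) \<le> M * ?q"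
        by (rule M)
      have "(\<xi> t)\<^sup>2 \<le> 2 * H0 / \<mu>"
        using H_ge(3)[where y = "x t" and q = "p t" and s = "\<xi> t"] H_le[OF that] \<open>\<mu> > 0\<close>
        by (smt (verit) divide_right_mono)
      then have \<xi>_le: "\<bar>\<xi> t\<bar> \<le> sqrt (2 * H0 / \<mu>)"
        by (simp add: real_le_rsqrt)
      have "\<bar>(x t - xstar) \<bullet> (A (x t) *v p t)\<bar> \<le> ?n * (M * ?q)"
        using Cauchy_Schwarz_ineq2 Ap by (meson mult_left_mono norm_ge_zero order_trans)
      then have "\<bar>\<xi> t * ((x t - xstar) \<bullet> (A (x t) *v p t))\<bar> \<le> sqrt (2 * H0 / \<mu>) * (?n * (M * ?q))"
        unfolding abs_mult using \<xi>_le H_ge(4)[of x0 p0 \<xi>0] \<open>\<mu> > 0\<close>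
        by (intro mult_mono) (auto simp: H0_def)
      also have "\<dots> = K * ?n * ?q"
        by (simp add: K_def)
      \<comment> \<open>Young's inequality, weighted so that the position term is absorbed exactly
        by the \<open>b\<close> term of \<open>conv\<close>.\<close>
      also have "\<dots> \<le> b * ?n\<^sup>2 + K\<^sup>2 / (4 * b) * ?q\<^sup>2"
      proof -
        have "0 \<le> (2 * b * ?n - K * ?q)\<^sup>2"
          by simp
        then have "4 * b * (K * ?n * ?q) \<le> 4 * b * (b * ?n\<^sup>2) + K\<^sup>2 * ?q\<^sup>2"
          by (simp add: power2_diff power_mult_distrib power2_eq_square algebra_simps)
        then show ?thesis
          using ab by (simp add: field_simps)
      qed
      finally show ?thesis
        using conv[of "x t"] by (simp add: N_def algebra_simps)
    qed
    have "?H t + \<epsilon> * ?W t \<le> (?H 0 + \<epsilon> * ?W 0) * exp (- k * t)"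
    proof (rule exponential_decay_on_halfline[OF _ _ \<open>t \<ge> 0\<close>])
      fix t :: real assume "t \<ge> 0"
      let ?H' = "- \<gamma> * (norm (p t))\<^sup>2 - \<alpha> * \<mu> * (\<xi> t)\<^sup>2"
      let ?W' = "(norm (p t))\<^sup>2 - (x t - xstar) \<bullet> gradient f (x t)
        - \<xi> t * ((x t - xstar) \<bullet> (A (x t) *v p t))"
      show "((\<lambda>t. ?H t + \<epsilon> * ?W t) has_real_derivative ?H' + \<epsilon> * ?W') (at t within {0..})"
        by (intro DERIV_add DERIV_cmult H' W' \<open>t \<ge> 0\<close>)
      have "\<epsilon> * ?W' \<le> \<epsilon> * (N * (norm (p t))\<^sup>2 - a * (f (x t) - f xstar))"
        using W'_le[OF \<open>t \<ge> 0\<close>] \<epsilon> by simp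
      also have "\<dots> = (\<epsilon> * N) * (norm (p t))\<^sup>2 - \<epsilon> * a * (f (x t) - f xstar)"
        by (simp add: algebra_simps)
      \<comment> \<open>The remaining dissipation is arranged by the three summands of
        \<open>H\<close>, so that each coefficient can be compared with \<open>l\<close>.\<close>
      finally have "?H' + \<epsilon> * ?W' \<le>
          - (\<gamma> * ((norm (p t))\<^sup>2 / 2) + 2 * \<alpha> * (\<mu> * (\<xi> t)\<^sup>2 / 2) + \<epsilon> * a * (f (x t) - f xstar))"
        unfolding \<epsilon>(3) by simp
      also have "\<dots> \<le> - (l * ((norm (p t))\<^sup>2 / 2) + l * (\<mu> * (\<xi> t)\<^sup>2 / 2) + l * (f (x t) - f xstar))"
        unfolding neg_le_iff_le using \<open>\<mu> > 0\<close> min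
        by (intro add_mono mult_right_mono) (auto simp: l_def)
      also have "\<dots> = - l * ?H t"
        by (simp add: H_def dot_square_norm algebra_simps)
      also have "\<dots> = - k * (c * ?H t)"
        using \<open>c > 0\<close> by (simp add: k_def)
      \<comment> \<open>The upper comparison \<open>upper\<close> closes the differential
        inequality; \<open>lower\<close> will then transfer the decay back to
        \<open>H\<close>.\<close>
      also have "\<dots> \<le> - k * (?H t + \<epsilon> * ?W t)"
        using upper \<open>k > 0\<close> by simp
      finally show "?H' + \<epsilon> * ?W' \<le> - k * (?H t + \<epsilon> * ?W t)" .
    qed
    then have "2 * (?H t + \<epsilon> * ?W t) \<le> 2 * (L0 * exp (- k * t))"
      by (simp add: L0_def H0_def init)
    with lower have decay: "?H t \<le> 2 * L0 * exp (- k * t)"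
      unfolding mult.assoc by (rule order_trans)
    have sq: "exp (- k * t) = (exp (- \<kappa> * t))\<^sup>2"
      by (simp add: \<kappa>_def power2_eq_square flip: exp_add)
    have "exp (- k * t) \<le> exp (- \<kappa> * t)"
      using \<open>k > 0\<close> \<open>t \<ge> 0\<close> by (simp add: \<kappa>_def)
    then have "f (x t) - f xstar \<le> 2 * L0 * exp (- \<kappa> * t)"
      using decay H_ge(1)[of "x t" "p t" "\<xi> t"] \<open>L0 \<ge> 0\<close>
      by (smt (verit) mult_left_mono)
    moreover have "norm (p t) \<le> sqrt (4 * L0) * exp (- \<kappa> * t)"
    proof (rule power2_le_imp_le)
      show "(norm (p t))\<^sup>2 \<le> (sqrt (4 * L0) * exp (- \<kappa> * t))\<^sup>2"
        using decay H_ge(2)[of "p t" "x t" "\<xi> t"] \<open>L0 \<ge> 0\<close>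
        unfolding power_mult_distrib sq by simp
    qed (use \<open>L0 \<ge> 0\<close> in simp)
    moreover have "\<xi> t \<le> sqrt (4 * L0 / \<mu>) * exp (- \<kappa> * t)"
    proof (rule power2_le_imp_le)
      have "(\<xi> t)\<^sup>2 \<le> 2 * (2 * L0 * exp (- k * t)) / \<mu>"
        using decay H_ge(3)[where y = "x t" and q = "p t" and s = "\<xi> t"] \<open>\<mu> > 0\<close>
        by (smt (verit) divide_right_mono)
      then show "(\<xi> t)\<^sup>2 \<le> (sqrt (4 * L0 / \<mu>) * exp (- \<kappa> * t))\<^sup>2"
        using \<open>L0 \<ge> 0\<close> \<open>\<mu> > 0\<close> unfolding power_mult_distrib sq by simp
    qed (use \<open>L0 \<ge> 0\<close> \<open>\<mu> > 0\<close> in simp)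
    ultimately show ?thesis
      by (simp add: C_def algebra_simps)
  qed
  then show "\<exists>\<kappa>>0. \<exists>C\<ge>0. \<forall>x p \<xi>.
      FAD_solution f A \<mu> \<alpha> \<gamma> x p \<xi> \<and> x 0 = x0 \<and> p 0 = p0 \<and> \<xi> 0 = \<xi>0 \<longrightarrow>
      (\<forall>t\<ge>0. f (x t) - f xstar + norm (p t) + \<xi> t \<le> C * exp (- \<kappa> * t))"
    using \<open>\<kappa> > 0\<close> \<open>C \<ge> 0\<close> by blast
qed

end
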